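(* Let $\{x^k\}_{k\ge0}$ be a monotone randomized algorithm (MRA) with data $(S,g,h,c_1,c_2,c_3,\{\alpha_k\})$, suppose the stepsize condition holds, and suppose the global unified error bound (GUEB) holds with modulus $\phi_S$. Assume that $1/\phi_S$ is integrable near $0$. Then there exist an almost surely finite random index $K_1$ and a random variable $x^*$ such that, almost surely, $x^*\in\arg\min_{x\in S}h(x)$ and $x^k=x^*$ for all $k\ge K_1$.
   Context: MRA. $(\Omega,\mathcal F,\{\mathcal F_k\}_{k\ge0},\mathbb P)$ is a filtered probability space and $\{x^k\}_{k\ge0}$ is a sequence of random vectors in $\mathbb R^d$ adapted to $\{\mathcal F_k\}$, with deterministic $x^0$. It is a monotone randomized algorithm (MRA) if there are a closed set $S\subseteq\mathbb R^d$, continuous functions $g,h:S\to\mathbb R$ with $g\ge0$ and $h^*:=\inf_{x\in S}h(x)>-\infty$, constants $c_1,c_2,c_3>0$ with $c_3\ge c_2$, and a positive (deterministic) sequence $\{\alpha_k\}_{k\ge0}$ such that for all $k\ge0$: $x^k\in S$; $h(x^{k+1})\le h(x^k)-\frac{c_1}{\alpha_k}\|x^{k+1}-x^k\|^2$; $\mathbb E[\|x^{k+1}-x^k\|^2\mid\mathcal F_k]\ge c_2\alpha_k^2g(x^k)$ almost surely; $\|x^{k+1}-x^k\|^2\le c_3\alpha_k^2g(x^k)$. Stepsize condition. There is $\bar\alpha>0$ with $0<\alpha_k\le\bar\alpha$ for all $k$, and $\sum_{k=0}^\infty\alpha_k=+\infty$. GUEB. There is a function $\phi_S:[0,\tau)\to\mathbb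 R_+$, $\tau\in(0,+\infty]$, such that $\phi_S(h(x)-h^* )\le g(x)$ for all $x\in S$; $\phi_S$ is non-decreasing and strictly positive on $(0,\tau)$ with $\phi_S(0)=0$; and $0\le h(x)-h^*<\tau$ for all $x\in S$. A function $[0,\tau)\to[0,+\infty]$ is integrable near $0$ if it is integrable on $[0,\tau']$ for some $\tau'\in(0,\tau)$. *)

theory Defs
  imports "HOL-Probability.Probability" "HOL-Library.Extended_Nat"
begin

definition filtered_prob_space :: "'a measure \<Rightarrow> (nat \<Rightarrow> 'a measure) \<Rightarrow> bool" where
  "filtered_prob_space M F \<longleftrightarrow>
     prob_space M \<and> filtration (space M) F \<and> (\<forall>k. subalgebra M (F k))"

text \<open>
  The optimal value. The real-valued infimum is meaningful only for nonempty \<open>S\<close> and \<open>h\<close> bounded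
  below on \<open>S\<close>; both hold for the data of a monotone randomized algorithm, where \<open>S\<close> contains the
  deterministic starting point.
\<close>
definition opt_value :: "(real ^ 'd) set \<Rightarrow> (real ^ 'd \<Rightarrow> real) \<Rightarrow> real" where
  "opt_value S h = (INF x\<in>S. h x)"

text \<open>
  The functions \<open>g\<close> and \<open>h\<close> are total in the logic, but only their values on \<open>S\<close> are constrained.
  All conditions on the iterates are pathwise except the one on the conditional expectation.
  The squared step lengths are bounded (by induction from the deterministic start), hence
  integrable, so \<open>real_cond_exp\<close> is the ordinary conditional expectation.
\<close>
definition monotone_randomized_algorithm ::
  "'a measure \<Rightarrow> (nat \<Rightarrow> 'a measure) \<Rightarrow> (nat \<Rightarrow> 'a \<Rightarrow> real ^ 'd) \<Rightarrow> (real ^ 'd) set \<Rightarrow>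
   (real ^ 'd \<Rightarrow> real) \<Rightarrow> (real ^ 'd \<Rightarrow> real) \<Rightarrow> real \<Rightarrow> real \<Rightarrow> real \<Rightarrow> (nat \<Rightarrow> real) \<Rightarrow> bool"
where
  "monotone_randomized_algorithm M F x S g h c1 c2 c3 \<alpha> \<longleftrightarrow>
     filtered_prob_space M F \<and>
     (\<forall>k. x k \<in> borel_measurable (F k)) \<and>
     (\<exists>x0. \<forall>\<omega>\<in>space M. x 0 \<omega> = x0) \<and>
     closed S \<and> continuous_on S g \<and> continuous_on S h \<and>
     (\<forall>y\<in>S. 0 \<le> g y) \<and> bdd_below (h ` S) \<and>
     0 < c1 \<and> 0 < c2 \<and> 0 < c3 \<and> c2 \<le> c3 \<and> (\<forall>k. 0 < \<alpha> k) \<and>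
     (\<forall>k. \<forall>\<omega>\<in>space M. x k \<omega> \<in> S) \<and>
     (\<forall>k. \<forall>\<omega>\<in>space M.
        h (x (Suc k) \<omega>) \<le> h (x k \<omega>) - c1 / \<alpha> k * (norm (x (Suc k) \<omega> - x k \<omega>))\<^sup>2) \<and>
     (\<forall>k. AE \<omega> in M.
        c2 * (\<alpha> k)\<^sup>2 * g (x k \<omega>)
          \<le> real_cond_exp M (F k) (\<lambda>\<omega>'. (norm (x (Suc k) \<omega>' - x k \<omega>'))\<^sup>2) \<omega>) \<and>
     (\<forall>k. \<forall>\<omega>\<in>space M.
        (norm (x (Suc k) \<omega> - x k \<omega>))\<^sup>2 \<le> c3 * (\<alpha> k)\<^sup>2 * g (x k \<omega>))"

definition stepsize_condition :: "(nat \<Rightarrow> real) \<Rightarrow> bool" where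
  "stepsize_condition \<alpha> \<longleftrightarrow>
     (\<exists>abar>0. \<forall>k. 0 < \<alpha> k \<and> \<alpha> k \<le> abar) \<and>
     filterlim (\<lambda>n. \<Sum>k<n. \<alpha> k) at_top sequentially"

text \<open>The modulus \<open>\<phi>\<close> is only constrained on its domain \<open>[0, \<tau>)\<close>, where \<open>\<tau>\<close> may be infinite.\<close>
definition GUEB ::
  "(real ^ 'd) set \<Rightarrow> (real ^ 'd \<Rightarrow> real) \<Rightarrow> (real ^ 'd \<Rightarrow> real) \<Rightarrow> ereal \<Rightarrow> (real \<Rightarrow> real) \<Rightarrow> bool"
where
  "GUEB S g h \<tau> \<phi> \<longleftrightarrow>
     0 < \<tau> \<and>
     (\<forall>t. 0 \<le> t \<and> ereal t < \<tau> \<longrightarrow> 0 \<le> \<phi> t) \<and>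
     (\<forall>y\<in>S. \<phi> (h y - opt_value S h) \<le> g y) \<and>
     mono_on {t. 0 \<le> t \<and> ereal t < \<tau>} \<phi> \<and>
     (\<forall>t. 0 < t \<and> ereal t < \<tau> \<longrightarrow> 0 < \<phi> t) \<and>
     \<phi> 0 = 0 \<and>
     (\<forall>y\<in>S. 0 \<le> h y - opt_value S h \<and> ereal (h y - opt_value S h) < \<tau>)"

definition integrable_near_0 :: "ereal \<Rightarrow> (real \<Rightarrow> ennreal) \<Rightarrow> bool" where
  "integrable_near_0 \<tau> f \<longleftrightarrow>
     (\<exists>\<tau>'. 0 < \<tau>' \<and> ereal \<tau>' < \<tau> \<and>
       f \<in> borel_measurable (lebesgue_on {0..\<tau>'}) \<and>
       (\<integral>\<^sup>+ t. f t \<partial>lebesgue_on {0..\<tau>'}) < \<infinity>)"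

end

theory Submission
  imports Defs
begin

text \<open>
  Let \<open>\<Phi>(t)\<close> be the integral of \<open>1 / \<phi>\<close> over \<open>[0, t]\<close>, which is finite by integrability near \<open>0\<close>.
  Since \<open>1 / \<phi>\<close> is non-increasing, a step that lowers the optimality gap \<open>D\<^sub>k = h(x\<^sup>k) - h\<^sup>*\<close> by
  \<open>(c\<^sub>1 / \<alpha>\<^sub>k) \<parallel>x\<^sup>k\<^sup>+\<^sup>1 - x\<^sup>k\<parallel>\<^sup>2\<close> lowers \<open>\<Phi>(D\<^sub>k)\<close> by at least that amount divided by \<open>\<phi>(D\<^sub>k)\<close>.
  Taking expectations, the conditional lower bound and the error bound cancel \<open>\<phi>(D\<^sub>k)\<close> and give
  \<open>\<bbbE> \<Phi>(D\<^sub>k) - \<bbbE> \<Phi>(D\<^sub>k\<^sub>+\<^sub>1) \<ge> c\<^sub>1 c\<^sub>2 \<alpha>\<^sub>k \<bbbP>(D\<^sub>k > 0)\<close>. Hence \<open>\<Sum>\<^sub>k \<alpha>\<^sub>k \<bbbP>(\<forall>j. D\<^sub>j > 0)\<close> is bounded, and as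
  \<open>\<Sum>\<^sub>k \<alpha>\<^sub>k\<close> diverges the gap almost surely vanishes at a finite index. From there on every step has
  length \<open>0\<close>.
\<close>

section \<open>Integrating the reciprocal of the modulus\<close>

lemma borel_measurable_mono_clamp:
  fixes \<phi> :: "real \<Rightarrow> real"
  assumes "mono_on {0..D} \<phi>" and "0 \<le> D"
  shows "(\<lambda>s. \<phi> (max 0 (min s D))) \<in> borel_measurable borel"
proof (rule borel_measurable_mono, rule monoI)
  fix s t :: real assume "s \<le> t"
  then show "\<phi> (max 0 (min s D)) \<le> \<phi> (max 0 (min t D))"
    using assms by (intro mono_onD[OF assms(1)]) (auto simp: max_def min_def)
qed

text \<open>The hypothesis controls \<open>1 / \<phi>\<close> only up to some
  \<open>\<tau>'\<close>, and \<open>D\<close> may be larger. Beyond \<open>\<tau>'\<close>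
  monotonicity gives the constant bound \<open>1 / \<phi> \<tau>'\<close>, so the two pieces
  together dominate the integrand.\<close>

lemma integrable_reciprocal:
  fixes \<phi> :: "real \<Rightarrow> real"
  assumes "0 \<le> D" and "ereal D < \<tau>"
    and mono: "mono_on {t. 0 \<le> t \<and> ereal t < \<tau>} \<phi>"
    and pos: "\<And>t. 0 < t \<Longrightarrow> ereal t < \<tau> \<Longrightarrow> 0 < \<phi> t"
    and "integrable_near_0 \<tau> (\<lambda>t. 1 / ennreal (\<phi> t))"
  shows "integrable lborel (\<lambda>s. indicator {0<..D} s / \<phi> s)"
proof -
  have lt: "ereal t < \<tau>" if "t \<le> D" for t
    using that \<open>ereal D < \<tau>\<close> by (meson ereal_less_eq(3) order_le_less_trans)
  have mono_0D: "mono_on {0..D} \<phi>"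
    using lt by (intro mono_on_subset[OF mono]) auto
  obtain \<tau>' where \<tau>': "0 < \<tau>'" "ereal \<tau>' < \<tau>"
    and meas': "(\<lambda>t. 1 / ennreal (\<phi> t)) \<in> borel_measurable (lebesgue_on {0..\<tau>'})"
    and fin: "(\<integral>\<^sup>+ t. 1 / ennreal (\<phi> t) \<partial>lebesgue_on {0..\<tau>'}) < \<infinity>"
    using assms(5) unfolding integrable_near_0_def by blast
  note [measurable] = borel_measurable_mono_clamp[OF mono_0D \<open>0 \<le> D\<close>]
  have eq: "indicator {0<..D} s / \<phi> s = indicator {0<..D} s / \<phi> (max 0 (min s D))" for s
    by (auto simp: indicator_def max_def min_def)
  have meas [measurable]: "(\<lambda>s. indicator {0<..D} s / \<phi> s) \<in> borel_measurable borel"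
    unfolding eq by measurable
  have bound: "ennreal (norm (indicator {0<..D} s / \<phi> s))
      \<le> 1 / ennreal (\<phi> s) * indicator {0..\<tau>'} s + ennreal (1 / \<phi> \<tau>') * indicator {0..D} s" for s
  proof (cases "0 < s \<and> s \<le> D")
    case True
    then have ps: "0 < \<phi> s" using pos lt by auto
    show ?thesis
    proof (cases "s \<le> \<tau>'")
      case True
      then show ?thesis using ps \<open>0 < s \<and> s \<le> D\<close>
        by (simp add: divide_ennreal[of 1, simplified])
    next
      case False
      have "\<phi> \<tau>' \<le> \<phi> s"
        using False \<tau>' \<open>0 < s \<and> s \<le> D\<close> lt by (intro mono_onD[OF mono]) auto
      moreover have "0 < \<phi> \<tau>'" using pos \<tau>' by auto
      ultimately have "1 / \<phi> s \<le> 1 / \<phi> \<tau>'" by (simp add: frac_le)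
      then show ?thesis using ps False \<open>0 < s \<and> s \<le> D\<close>
        by (simp add: ennreal_leI)
    qed
  next
    case False then show ?thesis by (simp add: indicator_def)
  qed
  \<comment> \<open>The majorant is only known to be Lebesgue measurable, so the estimate runs in
    \<open>lebesgue\<close>. The dominated function is Borel, which allows the return to
    \<open>lborel\<close> at the end.\<close>
  have "(\<integral>\<^sup>+ s. 1 / ennreal (\<phi> s) * indicator {0..\<tau>'} s \<partial>lebesgue) < \<infinity>"
    using fin by (subst (asm) nn_integral_restrict_space) auto
  moreover have "(\<integral>\<^sup>+ s. ennreal (1 / \<phi> \<tau>') * indicator {0..D} s \<partial>lebesgue) < \<infinity>"
    using \<open>0 \<le> D\<close> by (subst nn_integral_cmult_indicator) (auto simp: ennreal_mult_less_top)
  moreover have "(\<lambda>s. 1 / ennreal (\<phi> s) * indicator {0..\<tau>'} s) \<in> borel_measurable lebesgue"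
    using meas' by (subst (asm) borel_measurable_restrict_space_iff_ennreal) auto
  ultimately have "(\<integral>\<^sup>+ s. 1 / ennreal (\<phi> s) * indicator {0..\<tau>'} s
      + ennreal (1 / \<phi> \<tau>') * indicator {0..D} s \<partial>lebesgue) < \<infinity>"
    by (subst nn_integral_add) (auto intro: measurable_completion)
  then have "(\<integral>\<^sup>+ s. ennreal (norm (indicator {0<..D} s / \<phi> s)) \<partial>lebesgue) < \<infinity>"
    by (rule le_less_trans[OF nn_integral_mono, rotated]) (rule bound)
  then show ?thesis
    by (intro integrableI_bounded) (auto simp: nn_integral_completion)
qed

text \<open>On (a, b] the integrand \<open>1 / \<phi>\<close> is at least its value at b, which
  bounds the increment of its primitive from below.\<close>

lemma desingularizing_function_exists:
  fixes \<phi> :: "real \<Rightarrow> real"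
  assumes int: "integrable lborel (\<lambda>s. indicator {0<..D} s / \<phi> s)"
    and mono: "mono_on {0..D} \<phi>"
    and pos: "\<And>t. 0 < t \<Longrightarrow> t \<le> D \<Longrightarrow> 0 < \<phi> t"
  obtains \<Phi> :: "real \<Rightarrow> real" where "mono \<Phi>" and "\<And>t. 0 \<le> \<Phi> t"
    and "\<And>a b. 0 \<le> a \<Longrightarrow> a \<le> b \<Longrightarrow> 0 < b \<Longrightarrow> b \<le> D \<Longrightarrow> (b - a) / \<phi> b \<le> \<Phi> b - \<Phi> a"
proof -
  define f where "f s = indicator {0<..D} s / \<phi> s" for s
  have nonneg: "0 \<le> f s" for s
    using pos[of s] by (auto simp: f_def indicator_def)
  have intf: "integrable lborel (\<lambda>s. indicator A s * f s)" if "A \<in> sets borel" for A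
    using integrable_mult_indicator[of A lborel f] that int unfolding f_def by simp
  \<comment> \<open>As \<open>f\<close> vanishes outside (0, D], integrating over the whole
    half-line makes \<open>\<Phi>\<close> monotone on all of the reals, hence Borel
    measurable.\<close>
  define \<Phi> where "\<Phi> t = (\<integral>s. indicator {..t} s * f s \<partial>lborel)" for t
  have diff: "\<Phi> b - \<Phi> a = (\<integral>s. indicator {a<..b} s * f s \<partial>lborel)" if "a \<le> b" for a b
    unfolding \<Phi>_def using that
    by (subst Bochner_Integration.integral_diff[symmetric])
       (auto intro!: intf Bochner_Integration.integral_cong split: split_indicator)
  show ?thesis
  proof
    show "mono \<Phi>"
    proof (rule monoI)
      fix a b :: real assume "a \<le> b"
      then have "0 \<le> \<Phi> b - \<Phi> a" using nonneg by (subst diff) auto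
      then show "\<Phi> a \<le> \<Phi> b" by simp
    qed
    show "0 \<le> \<Phi> t" for t
      unfolding \<Phi>_def using nonneg by auto
    show "(b - a) / \<phi> b \<le> \<Phi> b - \<Phi> a" if ab: "0 \<le> a" "a \<le> b" "0 < b" "b \<le> D" for a b
    proof -
      have "(b - a) / \<phi> b = (\<integral>s. indicator {a<..b} s * (1 / \<phi> b) \<partial>lborel)"
        using \<open>a \<le> b\<close> by simp
      also have "\<dots> \<le> (\<integral>s. indicator {a<..b} s * f s \<partial>lborel)"
      proof (rule integral_mono)
        show "integrable lborel (\<lambda>s. indicator {a<..b} s * (1 / \<phi> b))"
          using \<open>a \<le> b\<close> by (intro integrable_mult_left) auto
        show "integrable lborel (\<lambda>s. indicator {a<..b} s * f s)"
          by (rule intf) simp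
        show "indicator {a<..b} s * (1 / \<phi> b) \<le> indicator {a<..b} s * f s" for s
        proof (cases "s \<in> {a<..b}")
          case True
          then have "\<phi> s \<le> \<phi> b" using ab by (intro mono_onD[OF mono]) auto
          moreover have "0 < \<phi> s" using True ab pos by auto
          ultimately show ?thesis using True ab by (simp add: f_def frac_le)
        qed simp
      qed
      finally show ?thesis using diff[OF \<open>a \<le> b\<close>] by simp
    qed
  qed
qed

text \<open>The weight is \<open>F\<close>-measurable, so it can be pulled out of the conditional
  expectation. Integrability is asked of the product only, which admits unbounded weights.\<close>

lemma (in finite_measure_subalgebra) weighted_cond_exp_lower_bound:
  fixes w y :: "'a \<Rightarrow> real"
  assumes "integrable M (\<lambda>\<omega>. w \<omega> * y \<omega>)"
    and "w \<in> borel_measurable F" and "y \<in> borel_measurable M" and "A \<in> sets M"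
    and "AE \<omega> in M. c * indicator A \<omega> \<le> w \<omega> * real_cond_exp M F y \<omega>"
  shows "c * measure M A \<le> (\<integral>\<omega>. w \<omega> * y \<omega> \<partial>M)"
proof -
  interpret sigma_finite_subalgebra M F
    by (rule finite_measure_subalgebra_is_sigma_finite) unfold_locales
  have "c * measure M A = (\<integral>\<omega>. c * indicator A \<omega> \<partial>M)"
    using \<open>A \<in> sets M\<close> by (simp add: sets.Int_space_eq2)
  also have "\<dots> \<le> (\<integral>\<omega>. w \<omega> * real_cond_exp M F y \<omega> \<partial>M)"
    using assms by (intro integral_mono_AE real_cond_exp_intg) (auto intro!: integrable_real_indicator simp: less_top[symmetric])
  also have "\<dots> = (\<integral>\<omega>. w \<omega> * y \<omega> \<partial>M)"
    using assms by (intro real_cond_exp_intg)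
  finally show ?thesis .
qed

theorem theorem5:
  fixes M :: "'a measure" and F :: "nat \<Rightarrow> 'a measure"
    and x :: "nat \<Rightarrow> 'a \<Rightarrow> real ^ 'd"
    and S :: "(real ^ 'd) set" and g h :: "real ^ 'd \<Rightarrow> real"
    and c1 c2 c3 :: real and \<alpha> :: "nat \<Rightarrow> real"
    and \<tau> :: ereal and \<phi> :: "real \<Rightarrow> real"
  assumes "monotone_randomized_algorithm M F x S g h c1 c2 c3 \<alpha>"
    and "stepsize_condition \<alpha>"
    and "GUEB S g h \<tau> \<phi>"
    and "integrable_near_0 \<tau> (\<lambda>t. 1 / ennreal (\<phi> t))"
  shows "\<exists>(K\<^sub>1 :: 'a \<Rightarrow> enat) (xstar :: 'a \<Rightarrow> real ^ 'd).
           K\<^sub>1 \<in> measurable M (count_space UNIV) \<and> (AE \<omega> in M. K\<^sub>1 \<omega> < \<infinity>) \<and>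
           xstar \<in> borel_measurable M \<and>
           (AE \<omega> in M. is_arg_min h (\<lambda>y. y \<in> S) (xstar \<omega>) \<and>
                       (\<forall>k. K\<^sub>1 \<omega> \<le> enat k \<longrightarrow> x k \<omega> = xstar \<omega>))"
proof -

  \<comment> \<open>Pathwise monotonicity of the optimality gap\<close>
  define hs where "hs = opt_value S h"
  define d where "d k \<omega> = h (x k \<omega>) - hs" for k \<omega>
  define y where "y k \<omega> = (norm (x (Suc k) \<omega> - x k \<omega>))\<^sup>2" for k \<omega>

  note mra = assms(1)[unfolded monotone_randomized_algorithm_def filtered_prob_space_def]
  have "prob_space M" and subalg: "subalgebra M (F k)" and xF [measurable]: "x k \<in> borel_measurable (F k)"
    and hcont: "continuous_on S h"
    and c1: "0 < c1" and c2: "0 < c2" and \<alpha>: "0 < \<alpha> k"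
    and cexp: "AE \<omega> in M. c2 * (\<alpha> k)\<^sup>2 * g (x k \<omega>) \<le> real_cond_exp M (F k) (y k) \<omega>" for k
    using mra unfolding y_def by auto
  have xS: "x k \<omega> \<in> S" and dec: "d (Suc k) \<omega> \<le> d k \<omega> - c1 / \<alpha> k * y k \<omega>"
    if "\<omega> \<in> space M" for k \<omega>
    using mra that unfolding d_def y_def by (auto simp: algebra_simps)
  interpret prob_space M by fact
  obtain \<omega>0 where "\<omega>0 \<in> space M" using not_empty by blast
  \<comment> \<open>The start is deterministic, so the initial gap is the same for all outcomes and
    \<open>\<Phi> D\<close> becomes a uniform bound on the potential.\<close>
  define D where "D = d 0 \<omega>0"
  have d0: "d 0 \<omega> = D" if "\<omega> \<in> space M" for \<omega>
    using mra that \<open>\<omega>0 \<in> space M\<close> unfolding D_def d_def by metis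

  note gueb = assms(3)[unfolded GUEB_def, folded hs_def]
  have mono: "mono_on {t. 0 \<le> t \<and> ereal t < \<tau>} \<phi>"
    using gueb by auto
  have pos: "0 < \<phi> t" if "0 < t" "ereal t < \<tau>" for t
    using gueb that by auto
  have hs_le: "hs \<le> h z" and gap_lt: "ereal (h z - hs) < \<tau>" and eb: "\<phi> (h z - hs) \<le> g z"
    if "z \<in> S" for z
    using gueb that by auto

  have ynn: "0 \<le> y k \<omega>" for k \<omega> unfolding y_def by simp
  have d_nonneg: "0 \<le> d k \<omega>" if "\<omega> \<in> space M" for k \<omega>
    using hs_le xS[OF that] unfolding d_def by auto
  have d_Suc: "d (Suc k) \<omega> \<le> d k \<omega>" if "\<omega> \<in> space M" for k \<omega>
  proof -
    have "0 \<le> c1 / \<alpha> k * y k \<omega>"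
      using c1 \<alpha>[of k] ynn[of k \<omega>] by simp
    then show ?thesis using dec[OF that, of k] by linarith
  qed
  have d_antimono: "d j \<omega> \<le> d k \<omega>" if "\<omega> \<in> space M" "k \<le> j" for j k \<omega>
    using \<open>k \<le> j\<close> by (rule lift_Suc_antimono_le[rotated]) (rule d_Suc[OF that(1)])
  have dD: "d k \<omega> \<le> D" if "\<omega> \<in> space M" for k \<omega>
    using d_antimono[OF that, of 0 k] d0[OF that] by simp
  have "0 \<le> D" and "ereal D < \<tau>"
    using \<open>\<omega>0 \<in> space M\<close> d_nonneg gap_lt xS unfolding D_def d_def by auto
  have lt: "ereal t < \<tau>" if "t \<le> D" for t
    using that \<open>ereal D < \<tau>\<close> by (meson ereal_less_eq(3) order_le_less_trans)
  have mono_0D: "mono_on {0..D} \<phi>"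
    using lt by (intro mono_on_subset[OF mono]) auto
  obtain \<Phi> where "mono \<Phi>" and \<Phi>_nonneg: "\<And>t. 0 \<le> \<Phi> t"
    and \<Phi>_diff: "\<And>a b. 0 \<le> a \<Longrightarrow> a \<le> b \<Longrightarrow> 0 < b \<Longrightarrow> b \<le> D \<Longrightarrow> (b - a) / \<phi> b \<le> \<Phi> b - \<Phi> a"
    using desingularizing_function_exists
      [OF integrable_reciprocal[OF \<open>0 \<le> D\<close> \<open>ereal D < \<tau>\<close> mono pos assms(4)] mono_0D] pos lt
    by metis
  have \<Phi>_le: "\<Phi> (d k \<omega>) \<le> \<Phi> D" if "\<omega> \<in> space M" for k \<omega>
    using \<open>mono \<Phi>\<close> dD[OF that] by (auto dest: monoD)

  \<comment> \<open>Measurability along the iterates\<close>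
  have spF: "space (F k) = space M" for k
    using subalg by (simp add: subalgebra_def)
  have dF [measurable]: "d k \<in> borel_measurable (F k)" for k
  proof -
    \<comment> \<open>\<open>h\<close> is continuous only on \<open>S\<close>, so the iterates are
      viewed as maps into \<open>S\<close>.\<close>
    have "x k \<in> measurable (F k) (restrict_space borel S)"
      using xS spF by (intro measurable_restrict_space2) auto
    then have "(\<lambda>\<omega>. h (x k \<omega>)) \<in> borel_measurable (F k)"
      by (rule measurable_compose[OF _ borel_measurable_continuous_on_restrict[OF hcont]])
    then show ?thesis unfolding d_def by simp
  qed
  have dM [measurable]: "d k \<in> borel_measurable M" and xM [measurable]: "x k \<in> borel_measurable M" for k
    using measurable_from_subalg[OF subalg] dF xF by blast+
  have yM [measurable]: "y k \<in> borel_measurable M" for k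
    unfolding y_def by measurable
  have \<Phi>M [measurable]: "\<Phi> \<in> borel_measurable borel"
    using \<open>mono \<Phi>\<close> by (rule borel_measurable_mono)
  have \<Phi>int: "integrable M (\<lambda>\<omega>. \<Phi> (d k \<omega>))" for k
    using \<Phi>_nonneg \<Phi>_le by (intro integrable_const_bound[of _ "\<Phi> D"]) auto

  \<comment> \<open>Expected decrease of the potential\<close>
  define A where "A k = {\<omega> \<in> space M. 0 < d k \<omega>}" for k
  have A [measurable]: "A k \<in> sets M" for k
    unfolding A_def by measurable
  have potential_drop:
    "c1 * c2 * (\<alpha> k * prob (A k)) \<le> expectation (\<lambda>\<omega>. \<Phi> (d k \<omega>)) - expectation (\<lambda>\<omega>. \<Phi> (d (Suc k) \<omega>))"
    for k
  proof -
    interpret finite_measure_subalgebra M "F k" using subalg by unfold_locales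
    \<comment> \<open>The clamping only serves measurability: \<open>\<phi>\<close> is arbitrary outside \<open>[0, \<tau>)\<close>.\<close>
    define w where "w \<omega> = (if 0 < d k \<omega> then 1 / \<phi> (max 0 (min (d k \<omega>) D)) else 0)" for \<omega>
    have w_eq: "w \<omega> = (if 0 < d k \<omega> then 1 / \<phi> (d k \<omega>) else 0)" if "\<omega> \<in> space M" for \<omega>
      using dD[OF that, of k] by (simp add: w_def max_def min_def)
    have [measurable]: "w \<in> borel_measurable (F k)"
      unfolding w_def using measurable_compose[OF dF borel_measurable_mono_clamp[OF mono_0D \<open>0 \<le> D\<close>]]
      by measurable
    then have wM [measurable]: "w \<in> borel_measurable M"
      by (rule measurable_from_subalg[OF subalg])
    \<comment> \<open>Besides the descent in expectation, this yields the integrability of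
      \<open>w * y k\<close>: the right side is at most \<open>\<Phi> D\<close>.\<close>
    have drop: "c1 / \<alpha> k * (w \<omega> * y k \<omega>) \<le> \<Phi> (d k \<omega>) - \<Phi> (d (Suc k) \<omega>)" if "\<omega> \<in> space M" for \<omega>
    proof (cases "0 < d k \<omega>")
      case True
      have p: "0 < \<phi> (d k \<omega>)" using True pos lt dD[OF that] by auto
      have "c1 / \<alpha> k * (w \<omega> * y k \<omega>) = (c1 / \<alpha> k * y k \<omega>) / \<phi> (d k \<omega>)"
        using True w_eq[OF that] by simp
      also have "\<dots> \<le> (d k \<omega> - d (Suc k) \<omega>) / \<phi> (d k \<omega>)"
        using dec[OF that, of k] p by (intro divide_right_mono) auto
      also have "\<dots> \<le> \<Phi> (d k \<omega>) - \<Phi> (d (Suc k) \<omega>)"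
        using True that by (intro \<Phi>_diff d_nonneg d_Suc dD)
      finally show ?thesis .
    next
      case False
      then show ?thesis
        using \<open>mono \<Phi>\<close> d_Suc[OF that, of k] by (auto simp: w_def dest: monoD)
    qed
    have w_nonneg: "0 \<le> w \<omega>" if "\<omega> \<in> space M" for \<omega>
      using w_eq[OF that] pos[of "d k \<omega>"] lt dD[OF that, of k] by auto
    \<comment> \<open>The weight \<open>w\<close> itself may be unbounded, as \<open>\<phi>\<close> may tend to \<open>0\<close> at \<open>0\<close>.\<close>
    have wy: "integrable M (\<lambda>\<omega>. w \<omega> * y k \<omega>)"
    proof (rule integrable_const_bound[of _ "\<Phi> D * \<alpha> k / c1"])
      show "AE \<omega> in M. norm (w \<omega> * y k \<omega>) \<le> \<Phi> D * \<alpha> k / c1"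
      proof (rule AE_I2)
        fix \<omega> assume \<omega>: "\<omega> \<in> space M"
        have "c1 / \<alpha> k * (w \<omega> * y k \<omega>) \<le> \<Phi> D"
          using drop[OF \<omega>] \<Phi>_le[OF \<omega>, of k] \<Phi>_nonneg[of "d (Suc k) \<omega>"] by linarith
        then show "norm (w \<omega> * y k \<omega>) \<le> \<Phi> D * \<alpha> k / c1"
          using w_nonneg[OF \<omega>] ynn[of k \<omega>] c1 \<alpha>[of k] by (simp add: field_simps)
      qed
    qed measurable
    have "c2 * (\<alpha> k)\<^sup>2 * prob (A k) \<le> expectation (\<lambda>\<omega>. w \<omega> * y k \<omega>)"
    proof (rule weighted_cond_exp_lower_bound[OF wy])
      show "AE \<omega> in M. c2 * (\<alpha> k)\<^sup>2 * indicator (A k) \<omega> \<le> w \<omega> * real_cond_exp M (F k) (y k) \<omega>"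
        using cexp[of k] AE_space
      proof eventually_elim
        case (elim \<omega>)
        show ?case
        proof (cases "0 < d k \<omega>")
          case True
          have p: "0 < \<phi> (d k \<omega>)" using True pos lt dD[OF elim(2)] by auto
          have "c2 * (\<alpha> k)\<^sup>2 * \<phi> (d k \<omega>) \<le> c2 * (\<alpha> k)\<^sup>2 * g (x k \<omega>)"
            using eb[OF xS[OF elim(2)]] c2 unfolding d_def by (intro mult_left_mono) auto
          with elim(1) have "c2 * (\<alpha> k)\<^sup>2 * \<phi> (d k \<omega>) \<le> real_cond_exp M (F k) (y k) \<omega>" by linarith
          then show ?thesis using True p elim(2) by (simp add: w_eq A_def pos_le_divide_eq)
        qed (simp add: w_def A_def)
      qed
    qed auto
    then have "c1 / \<alpha> k * (c2 * (\<alpha> k)\<^sup>2 * prob (A k)) \<le> c1 / \<alpha> k * expectation (\<lambda>\<omega>. w \<omega> * y k \<omega>)"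
      using c1 \<alpha>[of k] by (intro mult_left_mono) auto
    also have "\<dots> = expectation (\<lambda>\<omega>. c1 / \<alpha> k * (w \<omega> * y k \<omega>))" by simp
    also have "\<dots> \<le> expectation (\<lambda>\<omega>. \<Phi> (d k \<omega>) - \<Phi> (d (Suc k) \<omega>))"
      by (intro integral_mono integrable_mult_right Bochner_Integration.integrable_diff wy \<Phi>int drop)
    also have "\<dots> = expectation (\<lambda>\<omega>. \<Phi> (d k \<omega>)) - expectation (\<lambda>\<omega>. \<Phi> (d (Suc k) \<omega>))"
      by (intro Bochner_Integration.integral_diff \<Phi>int)
    \<comment> \<open>One of the two stepsize factors cancels, so the non-summable first power
      remains.\<close>
    also have "c1 / \<alpha> k * (c2 * (\<alpha> k)\<^sup>2 * prob (A k)) = c1 * c2 * (\<alpha> k * prob (A k))"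
      using \<alpha>[of k] by (simp add: power2_eq_square)
    finally show ?thesis .
  qed

  \<comment> \<open>Almost sure arrival at gap zero in finite time\<close>
  define p where "p = prob (\<Inter>k. A k)"
  have "c1 * c2 * p * (\<Sum>k<n. \<alpha> k) \<le> \<Phi> D" for n
  proof -
    have "c1 * c2 * p * (\<Sum>k<n. \<alpha> k) = (\<Sum>k<n. c1 * c2 * (\<alpha> k * p))"
      by (simp add: sum_distrib_left mult_ac)
    \<comment> \<open>The probability \<open>p\<close> of never arriving bounds every
      \<open>prob (A k)\<close> from below and, being independent of k, factors out of the sum of
      stepsizes.\<close>
    also have "\<dots> \<le> (\<Sum>k<n. c1 * c2 * (\<alpha> k * prob (A k)))"
      unfolding p_def using c1 c2 less_imp_le[OF \<alpha>]
      by (intro sum_mono mult_left_mono finite_measure_mono) auto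
    also have "\<dots> \<le> (\<Sum>k<n. expectation (\<lambda>\<omega>. \<Phi> (d k \<omega>)) - expectation (\<lambda>\<omega>. \<Phi> (d (Suc k) \<omega>)))"
      by (intro sum_mono potential_drop)
    also have "\<dots> = expectation (\<lambda>\<omega>. \<Phi> (d 0 \<omega>)) - expectation (\<lambda>\<omega>. \<Phi> (d n \<omega>))"
      by (rule sum_lessThan_telescope')
    also have "\<dots> \<le> expectation (\<lambda>\<omega>. \<Phi> (d 0 \<omega>))"
      using \<Phi>_nonneg by simp
    also have "\<dots> = \<Phi> D"
      using d0 by (simp add: prob_space cong: Bochner_Integration.integral_cong)
    finally show ?thesis .
  qed
  then have bdd: "\<not> \<Phi> D < c1 * c2 * p * (\<Sum>k<n. \<alpha> k)" for n
    by (simp add: not_less)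
  have "\<not> 0 < p"
  proof
    assume "0 < p"
    then have "filterlim (\<lambda>n. c1 * c2 * p * (\<Sum>k<n. \<alpha> k)) at_top sequentially"
      using c1 c2 assms(2) unfolding stepsize_condition_def
      by (intro filterlim_tendsto_pos_mult_at_top[OF tendsto_const]) auto
    then have "\<forall>\<^sub>F n in sequentially. \<Phi> D < c1 * c2 * p * (\<Sum>k<n. \<alpha> k)"
      by (simp add: filterlim_at_top_dense)
    then show False using bdd by simp
  qed
  then have "p = 0" unfolding p_def by (simp add: zero_less_measure_iff)
  then have "AE \<omega> in M. \<omega> \<notin> (\<Inter>k. A k)"
    unfolding p_def by (intro AE_not_in) (auto simp: null_sets_def emeasure_eq_measure)
  then have hit: "AE \<omega> in M. \<exists>k. d k \<omega> = 0"
    using AE_space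
  proof eventually_elim
    case (elim \<omega>)
    then obtain k where "\<not> 0 < d k \<omega>" by (auto simp: A_def)
    then show ?case using d_nonneg[OF elim(2), of k] by (intro exI[of _ k]) simp
  qed

  \<comment> \<open>Freezing at a minimizer\<close>
  have stay: "x j \<omega> = x k \<omega>" if \<omega>: "\<omega> \<in> space M" and "d k \<omega> = 0" and "k \<le> j" for j k \<omega>
    using \<open>k \<le> j\<close>
  proof (induction j rule: dec_induct)
    case (step j)
    have "d j \<omega> = 0"
      using d_antimono[OF \<omega> step(1)] d_nonneg[OF \<omega>, of j] \<open>d k \<omega> = 0\<close> by simp
    \<comment> \<open>The next gap cannot be negative, so the sufficient decrease leaves no room for
      a nonzero step.\<close>
    then have "c1 / \<alpha> j * y j \<omega> \<le> 0"
      using dec[OF \<omega>, of j] d_nonneg[OF \<omega>, of "Suc j"] by simp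
    then have "y j \<omega> \<le> 0"
      using c1 \<alpha>[of j] by (simp add: mult_le_0_iff divide_le_0_iff)
    then show ?case using step.IH by (simp add: y_def)
  qed simp

  \<comment> \<open>On the null set where the gap never vanishes, \<open>LEAST\<close> still denotes
    some unspecified natural number. Hence \<open>K\<close> is finite everywhere, and only its
    meaning as a hitting time is almost sure.\<close>
  define K where "K \<omega> = (LEAST k. d k \<omega> = 0)" for \<omega>
  have [measurable]: "K \<in> measurable M (count_space UNIV)"
    unfolding K_def by measurable
  show ?thesis
  proof (intro exI[of _ "\<lambda>\<omega>. enat (K \<omega>)"] exI[of _ "\<lambda>\<omega>. x (K \<omega>) \<omega>"] conjI)
    show "(\<lambda>\<omega>. enat (K \<omega>)) \<in> measurable M (count_space UNIV)" by measurable
    show "(\<lambda>\<omega>. x (K \<omega>) \<omega>) \<in> borel_measurable M" by measurable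
    show "AE \<omega> in M. is_arg_min h (\<lambda>y. y \<in> S) (x (K \<omega>) \<omega>) \<and>
            (\<forall>k. enat (K \<omega>) \<le> enat k \<longrightarrow> x k \<omega> = x (K \<omega>) \<omega>)"
      using hit AE_space
    proof eventually_elim
      case (elim \<omega>)
      then have dK: "d (K \<omega>) \<omega> = 0" unfolding K_def by (auto intro: LeastI)
      then have "is_arg_min h (\<lambda>y. y \<in> S) (x (K \<omega>) \<omega>)"
        using xS[OF elim(2)] hs_le by (simp add: is_arg_min_def d_def not_less)
      moreover have "\<forall>k. enat (K \<omega>) \<le> enat k \<longrightarrow> x k \<omega> = x (K \<omega>) \<omega>"
        by (intro allI impI stay[OF elim(2) dK]) simp
      ultimately show ?case by blast
    qed
  qed simp
qed

end
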